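(* Let $\zeta,c$ be absolute constants such that $\frac{2}{1-\zeta}<c$. Suppose there exists an explicit bipartite graph $\Gamma:[n]\times[D]\to[m]$ with $n$ left vertices, $m$ right vertices and left degree $D$ such that every set $T\subseteq[n]$ with $|T|\leq c/\epsilon$ has at least $(1-\zeta)|T|D$ neighbours. Suppose also that $\Gamma$ can be stored in space $s$ and that for every $i\in[n]$ the neighbours of $i$ can be computed in time $t$. Then there exists a (deterministic) algorithm which, for every $x\in\mathbb{R}^n$ in the strict turnstile model, finds the $\ell_1$ $\epsilon$-heavy hitters of $x$ (returning a list of $\mathcal{O}(1/\epsilon)$ coordinates containing all of them), with space usage $m+s$, update time $\mathcal{O}(t)$ and query time $\mathcal{O}(n\cdot t)$.
   Context: Strict turnstile model: $x$, initially $0$, receives updates $(i,\Delta)$ changing $x_i$ to $x_i+\Delta$, with $x_i\geq0$ for all $i$ at all times. $x_i$ is an $\ell_1$ $\epsilon$-heavy hitter if $|x_i|\geq\epsilon\|x\|_1$.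
   Formalization: For x = 0 every coordinate is literally a heavy hitter, so no list of O(1/ε) coordinates can contain all n; containment is therefore claimed only for x ≠ 0. Also 0 ≤ ζ < 1 is assumed, and space m+s counts memory cells, with O(1) registers beyond those used to compute neighbours. *)

theory Defs
  imports Complex_Main
begin

text \<open>
  Algorithms are programs of a deterministic unit-cost RAM with two sorts of storage: \<open>w\<close>-bit words
  (naturals below \<open>2 ^ w\<close>, arithmetic modulo \<open>2 ^ w\<close>) and real numbers (field operations and
  comparisons only; there is no rounding and no conversion between reals and words).
  A program mentions finitely many registers. The random-access memory consists of a bank of words and
  a bank of reals, both of fixed length; an access out of range has no transition.
  The output is an append-only stream of words that the program cannot read back.
\<close>

datatype word_op = WAdd | WSub | WMul | WDiv | WMod | WAnd | WOr | WXor | WShl | WShr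

fun eval_word_op :: "nat \<Rightarrow> word_op \<Rightarrow> nat \<Rightarrow> nat \<Rightarrow> nat" where
  "eval_word_op w WAdd a b = (a + b) mod 2 ^ w"
| "eval_word_op w WSub a b = (a + (2 ^ w - b)) mod 2 ^ w"
| "eval_word_op w WMul a b = (a * b) mod 2 ^ w"
| "eval_word_op w WDiv a b = (a div b) mod 2 ^ w"
| "eval_word_op w WMod a b = (a mod b) mod 2 ^ w"
| "eval_word_op w WAnd a b = (Bit_Operations.and a b) mod 2 ^ w"
| "eval_word_op w WOr  a b = (Bit_Operations.or a b) mod 2 ^ w"
| "eval_word_op w WXor a b = (Bit_Operations.xor a b) mod 2 ^ w"
| "eval_word_op w WShl a b = (a * 2 ^ b) mod 2 ^ w"
| "eval_word_op w WShr a b = (a div 2 ^ b) mod 2 ^ w"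

datatype real_op = RAdd | RSub | RMul | RDiv

fun eval_real_op :: "real_op \<Rightarrow> real \<Rightarrow> real \<Rightarrow> real" where
  "eval_real_op RAdd a b = a + b"
| "eval_real_op RSub a b = a - b"
| "eval_real_op RMul a b = a * b"
| "eval_real_op RDiv a b = a / b"

text \<open>
  The \<open>nat\<close> arguments are register names, except for the second argument of \<open>WConst\<close>. In the load and
  store instructions the address is the content of the named word register.
\<close>

datatype test = WLess nat nat | WEq nat nat | RLess nat nat | REq nat nat

datatype com =
    Skip
  | WConst nat nat
  | WOp nat word_op nat nat   (* target, operation, operands *)
  | WLoad nat nat             (* target, address *)
  | WStore nat nat            (* address, source *)
  | RConst nat rat
  | ROp nat real_op nat nat
  | RLoad nat nat
  | RStore nat nat
  | Emit nat
  | Seq com com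
  | Cond test com com
  | While test com

record state =
  wreg :: "nat \<Rightarrow> nat"
  rreg :: "nat \<Rightarrow> real"
  wmem :: "nat list"
  rmem :: "real list"

fun holds :: "test \<Rightarrow> state \<Rightarrow> bool" where
  "holds (WLess a b) \<sigma> \<longleftrightarrow> wreg \<sigma> a < wreg \<sigma> b"
| "holds (WEq a b) \<sigma> \<longleftrightarrow> wreg \<sigma> a = wreg \<sigma> b"
| "holds (RLess a b) \<sigma> \<longleftrightarrow> rreg \<sigma> a < rreg \<sigma> b"
| "holds (REq a b) \<sigma> \<longleftrightarrow> rreg \<sigma> a = rreg \<sigma> b"

definition set_wreg :: "nat \<Rightarrow> nat \<Rightarrow> state \<Rightarrow> state" where
  "set_wreg r v \<sigma> = \<sigma>\<lparr>wreg := (wreg \<sigma>)(r := v)\<rparr>"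

definition set_rreg :: "nat \<Rightarrow> real \<Rightarrow> state \<Rightarrow> state" where
  "set_rreg r v \<sigma> = \<sigma>\<lparr>rreg := (rreg \<sigma>)(r := v)\<rparr>"

text \<open>
  \<open>exec w c \<sigma> k out \<sigma>'\<close>: with word length \<open>w\<close>, program \<open>c\<close> started in \<open>\<sigma>\<close> halts in \<open>\<sigma>'\<close> after \<open>k\<close> steps,
  having emitted \<open>out\<close>. Every instruction and every evaluation of a test is one step.
\<close>

inductive exec :: "nat \<Rightarrow> com \<Rightarrow> state \<Rightarrow> nat \<Rightarrow> nat list \<Rightarrow> state \<Rightarrow> bool" for w :: nat where
  Skip: "exec w Skip \<sigma> 1 [] \<sigma>"
| WConst: "exec w (WConst r v) \<sigma> 1 [] (set_wreg r (v mod 2 ^ w) \<sigma>)"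
| WOp: "exec w (WOp r f a b) \<sigma> 1 [] (set_wreg r (eval_word_op w f (wreg \<sigma> a) (wreg \<sigma> b)) \<sigma>)"
| WLoad: "wreg \<sigma> a < length (wmem \<sigma>) \<Longrightarrow>
    exec w (WLoad r a) \<sigma> 1 [] (set_wreg r (wmem \<sigma> ! wreg \<sigma> a) \<sigma>)"
| WStore: "wreg \<sigma> a < length (wmem \<sigma>) \<Longrightarrow>
    exec w (WStore a r) \<sigma> 1 [] (\<sigma>\<lparr>wmem := (wmem \<sigma>)[wreg \<sigma> a := wreg \<sigma> r]\<rparr>)"
| RConst: "exec w (RConst r q) \<sigma> 1 [] (set_rreg r (of_rat q) \<sigma>)"
| ROp: "exec w (ROp r f a b) \<sigma> 1 [] (set_rreg r (eval_real_op f (rreg \<sigma> a) (rreg \<sigma> b)) \<sigma>)"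
| RLoad: "wreg \<sigma> a < length (rmem \<sigma>) \<Longrightarrow>
    exec w (RLoad r a) \<sigma> 1 [] (set_rreg r (rmem \<sigma> ! wreg \<sigma> a) \<sigma>)"
| RStore: "wreg \<sigma> a < length (rmem \<sigma>) \<Longrightarrow>
    exec w (RStore a r) \<sigma> 1 [] (\<sigma>\<lparr>rmem := (rmem \<sigma>)[wreg \<sigma> a := rreg \<sigma> r]\<rparr>)"
| Emit: "exec w (Emit r) \<sigma> 1 [wreg \<sigma> r] \<sigma>"
| Seq: "exec w c1 \<sigma> k1 out1 \<sigma>1 \<Longrightarrow> exec w c2 \<sigma>1 k2 out2 \<sigma>2 \<Longrightarrow>
    exec w (Seq c1 c2) \<sigma> (k1 + k2) (out1 @ out2) \<sigma>2"
| CondTrue: "holds b \<sigma> \<Longrightarrow> exec w c1 \<sigma> k out \<sigma>' \<Longrightarrow> exec w (Cond b c1 c2) \<sigma> (Suc k) out \<sigma>'"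
| CondFalse: "\<not> holds b \<sigma> \<Longrightarrow> exec w c2 \<sigma> k out \<sigma>' \<Longrightarrow> exec w (Cond b c1 c2) \<sigma> (Suc k) out \<sigma>'"
| WhileFalse: "\<not> holds b \<sigma> \<Longrightarrow> exec w (While b c) \<sigma> 1 [] \<sigma>"
| WhileTrue: "holds b \<sigma> \<Longrightarrow> exec w c \<sigma> k1 out1 \<sigma>1 \<Longrightarrow> exec w (While b c) \<sigma>1 k2 out2 \<sigma>2 \<Longrightarrow>
    exec w (While b c) \<sigma> (Suc (k1 + k2)) (out1 @ out2) \<sigma>2"

inductive_cases exec_elims:
  "exec w Skip \<sigma> k out \<sigma>'"
  "exec w (WConst r v) \<sigma> k out \<sigma>'"
  "exec w (WOp r f a b) \<sigma> k out \<sigma>'"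
  "exec w (WLoad r a) \<sigma> k out \<sigma>'"
  "exec w (WStore a r) \<sigma> k out \<sigma>'"
  "exec w (RConst r q) \<sigma> k out \<sigma>'"
  "exec w (ROp r g a b) \<sigma> k out \<sigma>'"
  "exec w (RLoad r a) \<sigma> k out \<sigma>'"
  "exec w (RStore a r) \<sigma> k out \<sigma>'"
  "exec w (Emit r) \<sigma> k out \<sigma>'"
  "exec w (Seq c1 c2) \<sigma> k out \<sigma>'"
  "exec w (Cond b c1 c2) \<sigma> k out \<sigma>'"
  "exec w (While b c) \<sigma> k out \<sigma>'"

lemma exec_deterministic:
  assumes "exec w c \<sigma> k out \<sigma>'" and "exec w c \<sigma> k' out' \<sigma>''"
  shows "k = k' \<and> out = out' \<and> \<sigma>' = \<sigma>''"
  using assms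
proof (induction arbitrary: k' out' \<sigma>'' rule: exec.induct)
  case (Seq c1 \<sigma> k1 out1 \<sigma>1 c2 k2 out2 \<sigma>2)
  from Seq.prems obtain l1 o1 \<tau> l2 o2 where *: "exec w c1 \<sigma> l1 o1 \<tau>" "exec w c2 \<tau> l2 o2 \<sigma>''"
    "k' = l1 + l2" "out' = o1 @ o2"
    by - (erule exec_elims(11), (auto; fail)+)
  with Seq.IH(1)[OF *(1)] Seq.IH(2)[of l2 o2 \<sigma>''] show ?case by simp
next
  case (CondTrue b \<sigma> c1 k out \<sigma>' c2)
  from CondTrue.prems CondTrue.hyps obtain l where "exec w c1 \<sigma> l out' \<sigma>''" "k' = Suc l"
    by - (erule exec_elims(12), (auto; fail)+)
  with CondTrue.IH show ?case by blast
next
  case (CondFalse b \<sigma> c2 k out \<sigma>' c1)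
  from CondFalse.prems CondFalse.hyps obtain l where "exec w c2 \<sigma> l out' \<sigma>''" "k' = Suc l"
    by - (erule exec_elims(12), (auto; fail)+)
  with CondFalse.IH show ?case by blast
next
  case (WhileFalse b \<sigma> c)
  from WhileFalse.prems WhileFalse.hyps show ?case by - (erule exec_elims(13), (auto; fail)+)
next
  case (WhileTrue b \<sigma> c k1 out1 \<sigma>1 k2 out2 \<sigma>2)
  from WhileTrue.prems WhileTrue.hyps obtain l1 o1 \<tau> l2 o2 where *: "exec w c \<sigma> l1 o1 \<tau>"
    "exec w (While b c) \<tau> l2 o2 \<sigma>''" "k' = Suc (l1 + l2)" "out' = o1 @ o2"
    by - (erule exec_elims(13), (auto; fail)+)
  with WhileTrue.IH(1)[OF *(1)] WhileTrue.IH(2)[of l2 o2 \<sigma>''] show ?case by simp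
qed (erule exec_elims(1-10), simp)+

primrec wregs_test :: "test \<Rightarrow> nat set" where
  "wregs_test (WLess a b) = {a, b}"
| "wregs_test (WEq a b) = {a, b}"
| "wregs_test (RLess a b) = {}"
| "wregs_test (REq a b) = {}"

primrec rregs_test :: "test \<Rightarrow> nat set" where
  "rregs_test (WLess a b) = {}"
| "rregs_test (WEq a b) = {}"
| "rregs_test (RLess a b) = {a, b}"
| "rregs_test (REq a b) = {a, b}"

primrec wregs :: "com \<Rightarrow> nat set" where
  "wregs Skip = {}"
| "wregs (WConst r v) = {r}"
| "wregs (WOp r f a b) = {r, a, b}"
| "wregs (WLoad r a) = {r, a}"
| "wregs (WStore a r) = {a, r}"
| "wregs (RConst r q) = {}"
| "wregs (ROp r f a b) = {}"
| "wregs (RLoad r a) = {a}"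
| "wregs (RStore a r) = {a}"
| "wregs (Emit r) = {r}"
| "wregs (Seq c1 c2) = wregs c1 \<union> wregs c2"
| "wregs (Cond b c1 c2) = wregs_test b \<union> wregs c1 \<union> wregs c2"
| "wregs (While b c) = wregs_test b \<union> wregs c"

primrec rregs :: "com \<Rightarrow> nat set" where
  "rregs Skip = {}"
| "rregs (WConst r v) = {}"
| "rregs (WOp r f a b) = {}"
| "rregs (WLoad r a) = {}"
| "rregs (WStore a r) = {}"
| "rregs (RConst r q) = {r}"
| "rregs (ROp r f a b) = {r, a, b}"
| "rregs (RLoad r a) = {r}"
| "rregs (RStore a r) = {r}"
| "rregs (Emit r) = {}"
| "rregs (Seq c1 c2) = rregs c1 \<union> rregs c2"
| "rregs (Cond b c1 c2) = rregs_test b \<union> rregs c1 \<union> rregs c2"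
| "rregs (While b c) = rregs_test b \<union> rregs c"

definition register_count :: "com set \<Rightarrow> nat" where
  "register_count A = card (\<Union>c\<in>A. wregs c) + card (\<Union>c\<in>A. rregs c)"

text \<open>
  Memory cells (words and reals alike) count as space; the finitely many registers fixed by the program
  text are counted separately by \<open>register_count\<close>. Memory lengths never change during a run.
\<close>

definition space :: "state \<Rightarrow> nat" where
  "space \<sigma> = length (wmem \<sigma>) + length (rmem \<sigma>)"

lemma exec_space: "exec w c \<sigma> k out \<sigma>' \<Longrightarrow> space \<sigma>' = space \<sigma>"
  by (induction rule: exec.induct) (auto simp: space_def set_wreg_def set_rreg_def)

text \<open>Vectors in \<open>\<real>\<^sup>n\<close> are functions on \<open>{..<n}\<close>; a stream is a list of updates \<open>(i, \<Delta>)\<close>.\<close>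

definition stream_vector :: "(nat \<times> real) list \<Rightarrow> nat \<Rightarrow> real" where
  "stream_vector us = foldl (\<lambda>x (i, \<Delta>). x(i := x i + \<Delta>)) (\<lambda>_. 0) us"

definition strict_turnstile :: "nat \<Rightarrow> (nat \<times> real) list \<Rightarrow> bool" where
  "strict_turnstile n us \<longleftrightarrow>
     (\<forall>(i, \<Delta>) \<in> set us. i < n) \<and>
     (\<forall>k \<le> length us. \<forall>i < n. 0 \<le> stream_vector (take k us) i)"

definition l1_norm :: "nat \<Rightarrow> (nat \<Rightarrow> real) \<Rightarrow> real" where
  "l1_norm n x = (\<Sum>i<n. \<bar>x i\<bar>)"

definition heavy_hitters :: "nat \<Rightarrow> real \<Rightarrow> (nat \<Rightarrow> real) \<Rightarrow> nat set" where
  "heavy_hitters n \<epsilon> x = {i. i < n \<and> \<bar>x i\<bar> \<ge> \<epsilon> * l1_norm n x}"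

definition bipartite_graph :: "nat \<Rightarrow> nat \<Rightarrow> nat \<Rightarrow> (nat \<Rightarrow> nat \<Rightarrow> nat) \<Rightarrow> bool" where
  "bipartite_graph n D m \<Gamma> \<longleftrightarrow> (\<forall>i<n. \<forall>d<D. \<Gamma> i d < m)"

definition neighbours :: "nat \<Rightarrow> (nat \<Rightarrow> nat \<Rightarrow> nat) \<Rightarrow> nat set \<Rightarrow> nat set" where
  "neighbours D \<Gamma> T = (\<Union>i\<in>T. \<Gamma> i ` {..<D})"

definition expanding :: "nat \<Rightarrow> nat \<Rightarrow> (nat \<Rightarrow> nat \<Rightarrow> nat) \<Rightarrow> real \<Rightarrow> real \<Rightarrow> bool" where
  "expanding n D \<Gamma> k \<zeta> \<longleftrightarrow>
     (\<forall>T \<subseteq> {..<n}. real (card T) \<le> k \<longrightarrow>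
        real (card (neighbours D \<Gamma> T)) \<ge> (1 - \<zeta>) * real (card T) * real D)"

definition valid_words :: "nat \<Rightarrow> state \<Rightarrow> bool" where
  "valid_words w \<sigma> \<longleftrightarrow> (\<forall>r. wreg \<sigma> r < 2 ^ w) \<and> (\<forall>v \<in> set (wmem \<sigma>). v < 2 ^ w)"

text \<open>
  The program \<open>P\<close> represents \<open>\<Gamma>\<close> in \<open>s\<close> words of memory and lists the neighbours of a vertex in time \<open>t\<close>.
  \<open>R\<close> is the set of memory contents that represent \<open>\<Gamma>\<close>: \<open>P\<close> may use part of the \<open>s\<close> words as work space
  as long as it leaves a representation of \<open>\<Gamma>\<close> behind. \<open>P\<close> expects the vertex in word register \<open>0\<close>
  and nothing in particular in the other registers.
\<close>

definition stores_graph ::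
  "nat \<Rightarrow> com \<Rightarrow> nat list set \<Rightarrow> nat \<Rightarrow> nat \<Rightarrow> (nat \<Rightarrow> nat \<Rightarrow> nat) \<Rightarrow> nat \<Rightarrow> nat \<Rightarrow> bool" where
  "stores_graph w P R n D \<Gamma> s t \<longleftrightarrow>
     R \<noteq> {} \<and> (\<forall>M\<in>R. length M = s \<and> (\<forall>v \<in> set M. v < 2 ^ w)) \<and>
     (\<forall>i<n. \<forall>\<sigma>. valid_words w \<sigma> \<and> wmem \<sigma> \<in> R \<and> rmem \<sigma> = [] \<and> wreg \<sigma> 0 = i \<longrightarrow>
        (\<exists>k \<sigma>'. exec w P \<sigma> k (map (\<Gamma> i) [0..<D]) \<sigma>' \<and> k \<le> t \<and> wmem \<sigma>' \<in> R))"

text \<open>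
  A streaming algorithm is an update program \<open>U\<close> and a query program \<open>Q\<close>. An update receives \<open>i\<close> and \<open>\<Delta>\<close>,
  a query receives \<open>n\<close> and \<open>\<epsilon>\<close>, in the registers with number \<open>0\<close>; everything else in the state is
  carried over from the preceding operation. Initially the word memory holds \<open>M\<close> and all else is zero.
\<close>

definition init_state :: "nat list \<Rightarrow> nat \<Rightarrow> state" where
  "init_state M m = \<lparr>wreg = (\<lambda>_. 0), rreg = (\<lambda>_. 0), wmem = M, rmem = replicate m 0\<rparr>"

definition call :: "nat \<Rightarrow> real \<Rightarrow> state \<Rightarrow> state" where
  "call a b \<sigma> = set_wreg 0 a (set_rreg 0 b \<sigma>)"

inductive reachable ::
  "nat \<Rightarrow> com \<Rightarrow> com \<Rightarrow> nat \<Rightarrow> real \<Rightarrow> state \<Rightarrow> (nat \<times> real) list \<Rightarrow> state \<Rightarrow> bool"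
  for w :: nat and U Q :: com and n :: nat and \<epsilon> :: real and \<sigma>0 :: state where
  init: "reachable w U Q n \<epsilon> \<sigma>0 [] \<sigma>0"
| update: "reachable w U Q n \<epsilon> \<sigma>0 us \<sigma> \<Longrightarrow> exec w U (call i \<Delta> \<sigma>) k out \<sigma>' \<Longrightarrow>
    reachable w U Q n \<epsilon> \<sigma>0 (us @ [(i, \<Delta>)]) \<sigma>'"
| query: "reachable w U Q n \<epsilon> \<sigma>0 us \<sigma> \<Longrightarrow> exec w Q (call n \<epsilon> \<sigma>) k out \<sigma>' \<Longrightarrow>
    reachable w U Q n \<epsilon> \<sigma>0 us \<sigma>'"

text \<open>
  If \<open>x = 0\<close>, then all \<open>n\<close> coordinates satisfy \<open>\<bar>x i\<bar> \<ge> \<epsilon> * l1_norm n x\<close>, so no short list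
  contains them all; only the bound on the length is required in this case.
\<close>

definition finds_heavy_hitters ::
  "nat \<Rightarrow> com \<Rightarrow> com \<Rightarrow> state \<Rightarrow> nat \<Rightarrow> real \<Rightarrow> nat \<Rightarrow> nat \<Rightarrow> nat \<Rightarrow> real \<Rightarrow> bool" where
  "finds_heavy_hitters w U Q \<sigma>0 n \<epsilon> space_bound update_time query_time list_bound \<longleftrightarrow>
     (\<forall>us \<sigma>. strict_turnstile n us \<and> reachable w U Q n \<epsilon> \<sigma>0 us \<sigma> \<longrightarrow>
        space \<sigma> \<le> space_bound \<and>
        (\<forall>i \<Delta>. strict_turnstile n (us @ [(i, \<Delta>)]) \<longrightarrow>
           (\<exists>k out \<sigma>'. exec w U (call i \<Delta> \<sigma>) k out \<sigma>' \<and> k \<le> update_time)) \<and>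
        (\<exists>k out \<sigma>'. exec w Q (call n \<epsilon> \<sigma>) k out \<sigma>' \<and> k \<le> query_time \<and>
           set out \<subseteq> {..<n} \<and> real (length out) \<le> list_bound \<and>
           ((\<exists>i<n. stream_vector us i \<noteq> 0) \<longrightarrow>
              heavy_hitters n \<epsilon> (stream_vector us) \<subseteq> set out)))"

end

theory Submission imports Defs begin

text \<open>
  Keep one real counter per right vertex, holding the sum of \<open>x i\<close> over the edges \<open>(i, d)\<close> that end
  there, and keep \<open>\<parallel>x\<parallel>\<^sub>1\<close> in a register. A query reports every \<open>i\<close> all of whose counters are at least
  \<open>\<epsilon> \<parallel>x\<parallel>\<^sub>1\<close>. As \<open>x \<ge> 0\<close>, every heavy hitter is reported. The counters add up to \<open>D \<parallel>x\<parallel>\<^sub>1\<close>, so at most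
  \<open>D / \<epsilon>\<close> of them reach the threshold; if more than \<open>c / \<epsilon>\<close> vertices were reported, then
  \<open>\<lfloor>c / \<epsilon>\<rfloor> \<ge> c / (2 \<epsilon>)\<close> of them would have at least \<open>(1 - \<zeta>) c D / (2 \<epsilon>) > D / \<epsilon>\<close> neighbours.
  If \<open>\<epsilon> > 1\<close> or \<open>x = 0\<close>, the query reports nothing, because then \<open>\<O>(1 / \<epsilon>)\<close> may be below \<open>1\<close> or below \<open>n\<close>.

  On the machine, the update and the query run \<open>P\<close> with each \<open>Emit\<close> replaced by constantly many
  instructions that process the neighbour in registers not used by \<open>P\<close>.
\<close>

section \<open>Weakest preconditions\<close>

definition wp :: "nat \<Rightarrow> com \<Rightarrow> (nat \<Rightarrow> nat list \<Rightarrow> state \<Rightarrow> bool) \<Rightarrow> state \<Rightarrow> bool" where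
  "wp w c Q \<sigma> \<longleftrightarrow> (\<exists>k out \<sigma>'. exec w c \<sigma> k out \<sigma>' \<and> Q k out \<sigma>')"

lemma wp_mono:
  assumes "wp w c Q \<sigma>" and "\<And>k out \<sigma>'. exec w c \<sigma> k out \<sigma>' \<Longrightarrow> Q k out \<sigma>' \<Longrightarrow> Q' k out \<sigma>'"
  shows "wp w c Q' \<sigma>"
  using assms unfolding wp_def by blast

text \<open>Execution is deterministic, so the one run that \<open>wp\<close> promises is the given
  run. This makes termination statements usable for the arbitrary runs occurring in
  \<open>reachable\<close>.\<close>

lemma wp_exec: "wp w c Q \<sigma> \<Longrightarrow> exec w c \<sigma> k out \<sigma>' \<Longrightarrow> Q k out \<sigma>'"
  unfolding wp_def using exec_deterministic by blast

lemma wp_basic [simp]: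
  "wp w Skip Q \<sigma> = Q 1 [] \<sigma>"
  "wp w (WConst r v) Q \<sigma> = Q 1 [] (set_wreg r (v mod 2 ^ w) \<sigma>)"
  "wp w (WOp r f a b) Q \<sigma> = Q 1 [] (set_wreg r (eval_word_op w f (wreg \<sigma> a) (wreg \<sigma> b)) \<sigma>)"
  "wp w (WLoad r a) Q \<sigma> =
     (wreg \<sigma> a < length (wmem \<sigma>) \<and> Q 1 [] (set_wreg r (wmem \<sigma> ! wreg \<sigma> a) \<sigma>))"
  "wp w (WStore a r) Q \<sigma> =
     (wreg \<sigma> a < length (wmem \<sigma>) \<and> Q 1 [] (\<sigma>\<lparr>wmem := (wmem \<sigma>)[wreg \<sigma> a := wreg \<sigma> r]\<rparr>))"
  "wp w (RConst r q) Q \<sigma> = Q 1 [] (set_rreg r (of_rat q) \<sigma>)"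
  "wp w (ROp r g a b) Q \<sigma> = Q 1 [] (set_rreg r (eval_real_op g (rreg \<sigma> a) (rreg \<sigma> b)) \<sigma>)"
  "wp w (RLoad r a) Q \<sigma> =
     (wreg \<sigma> a < length (rmem \<sigma>) \<and> Q 1 [] (set_rreg r (rmem \<sigma> ! wreg \<sigma> a) \<sigma>))"
  "wp w (RStore a r) Q \<sigma> =
     (wreg \<sigma> a < length (rmem \<sigma>) \<and> Q 1 [] (\<sigma>\<lparr>rmem := (rmem \<sigma>)[wreg \<sigma> a := rreg \<sigma> r]\<rparr>))"
  "wp w (Emit r) Q \<sigma> = Q 1 [wreg \<sigma> r] \<sigma>"
  unfolding wp_def
  by (auto intro: exec.intros[unfolded One_nat_def] elim!: exec_elims(1-10))

lemma wp_Seq [simp]: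
  "wp w (Seq c1 c2) Q \<sigma> =
     wp w c1 (\<lambda>k1 out1 \<sigma>1. wp w c2 (\<lambda>k2 out2. Q (k1 + k2) (out1 @ out2)) \<sigma>1) \<sigma>"
  unfolding wp_def by (blast intro: exec.intros elim: exec_elims)

lemma wp_Cond [simp]:
  "wp w (Cond b c1 c2) Q \<sigma> =
     (if holds b \<sigma> then wp w c1 (\<lambda>k. Q (Suc k)) \<sigma> else wp w c2 (\<lambda>k. Q (Suc k)) \<sigma>)"
  unfolding wp_def by (auto intro: exec.intros elim!: exec_elims(12))

lemma wp_While:
  "wp w (While b c) Q \<sigma> =
     (if holds b \<sigma>
      then wp w c (\<lambda>k1 out1 \<sigma>1. wp w (While b c) (\<lambda>k2 out2. Q (Suc (k1 + k2)) (out1 @ out2)) \<sigma>1) \<sigma>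
      else Q 1 [] \<sigma>)"
proof (cases "holds b \<sigma>")
  case True
  then show ?thesis
    unfolding wp_def by simp (blast intro: exec.WhileTrue elim: exec_elims)
next
  case False
  then show ?thesis
    unfolding wp_def by (auto intro: exec.WhileFalse[unfolded One_nat_def] elim: exec_elims(13))
qed

lemma set_reg_simps [simp]:
  "wreg (set_wreg r v \<sigma>) = (wreg \<sigma>)(r := v)" "rreg (set_wreg r v \<sigma>) = rreg \<sigma>"
  "wmem (set_wreg r v \<sigma>) = wmem \<sigma>" "rmem (set_wreg r v \<sigma>) = rmem \<sigma>"
  "wreg (set_rreg r y \<sigma>) = wreg \<sigma>" "rreg (set_rreg r y \<sigma>) = (rreg \<sigma>)(r := y)"
  "wmem (set_rreg r y \<sigma>) = wmem \<sigma>" "rmem (set_rreg r y \<sigma>) = rmem \<sigma>"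
  by (simp_all add: set_wreg_def set_rreg_def)

lemma call_simps [simp]:
  "wreg (call a b \<sigma>) = (wreg \<sigma>)(0 := a)" "rreg (call a b \<sigma>) = (rreg \<sigma>)(0 := b)"
  "wmem (call a b \<sigma>) = wmem \<sigma>" "rmem (call a b \<sigma>) = rmem \<sigma>"
  by (simp_all add: call_def)

lemma eval_word_op_less: "eval_word_op w f a b < 2 ^ w"
  by (cases f) simp_all

lemma valid_words_set_wreg: "valid_words w \<sigma> \<Longrightarrow> v < 2 ^ w \<Longrightarrow> valid_words w (set_wreg r v \<sigma>)"
  by (simp add: valid_words_def)

lemma valid_words_set_rreg [simp]: "valid_words w (set_rreg r y \<sigma>) = valid_words w \<sigma>"
  by (simp add: valid_words_def)

text \<open>\<open>stores_graph\<close> promises something only from states whose words are in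
  range, so this property has to survive every operation.\<close>

lemma exec_valid_words: "exec w c \<sigma> k out \<sigma>' \<Longrightarrow> valid_words w \<sigma> \<Longrightarrow> valid_words w \<sigma>'"
proof (induction rule: exec.induct)
  case (WStore \<sigma> a r)
  then show ?case
    using set_update_subset_insert[of "wmem \<sigma>" "wreg \<sigma> a" "wreg \<sigma> r"]
    by (auto simp: valid_words_def)
qed (auto simp: valid_words_set_wreg eval_word_op_less, auto simp: valid_words_def)

section \<open>Replacing the output instructions of a program\<close>

primrec map_emit :: "(nat \<Rightarrow> com) \<Rightarrow> com \<Rightarrow> com" where
  "map_emit E Skip = Skip"
| "map_emit E (WConst r v) = WConst r v"
| "map_emit E (WOp r f a b) = WOp r f a b"
| "map_emit E (WLoad r a) = WLoad r a"
| "map_emit E (WStore a r) = WStore a r"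
| "map_emit E (RConst r q) = RConst r q"
| "map_emit E (ROp r g a b) = ROp r g a b"
| "map_emit E (RLoad r a) = RLoad r a"
| "map_emit E (RStore a r) = RStore a r"
| "map_emit E (Emit r) = E r"
| "map_emit E (Seq c1 c2) = Seq (map_emit E c1) (map_emit E c2)"
| "map_emit E (Cond b c1 c2) = Cond b (map_emit E c1) (map_emit E c2)"
| "map_emit E (While b c) = While b (map_emit E c)"

lemma wregs_map_emit:
  "(\<And>r. wregs (E r) \<subseteq> insert r A) \<Longrightarrow> wregs (map_emit E c) \<subseteq> wregs c \<union> A"
  by (induction c) (simp_all, blast+)

lemma rregs_map_emit: "(\<And>r. rregs (E r) \<subseteq> A) \<Longrightarrow> rregs (map_emit E c) \<subseteq> rregs c \<union> A"
  by (induction c) (simp_all, blast+)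

lemma finite_wregs: "finite (wregs c)"
proof (induction c)
  case (Cond b c1 c2) then show ?case by (cases b) simp_all
next
  case (While b c) then show ?case by (cases b) simp_all
qed simp_all

lemma finite_rregs: "finite (rregs c)"
proof (induction c)
  case (Cond b c1 c2) then show ?case by (cases b) simp_all
next
  case (While b c) then show ?case by (cases b) simp_all
qed simp_all

definition agree :: "nat \<Rightarrow> nat \<Rightarrow> state \<Rightarrow> state \<Rightarrow> bool" where
  "agree a b \<sigma> \<tau> \<longleftrightarrow>
     (\<forall>r<a. wreg \<sigma> r = wreg \<tau> r) \<and> (\<forall>r<b. rreg \<sigma> r = rreg \<tau> r) \<and> wmem \<sigma> = wmem \<tau>"

text \<open>The part of a state that the simulated program cannot touch, with registers renumbered
  from 0. An invariant on this triple only has to be checked for the handler.\<close>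

definition private_part ::
  "nat \<Rightarrow> nat \<Rightarrow> state \<Rightarrow> real list \<times> (nat \<Rightarrow> nat) \<times> (nat \<Rightarrow> real)" where
  "private_part a b \<tau> = (rmem \<tau>, (\<lambda>r. wreg \<tau> (a + r)), (\<lambda>r. rreg \<tau> (b + r)))"

lemma agree_holds:
  assumes "agree a b \<sigma> \<tau>" "wregs_test p \<subseteq> {..<a}" "rregs_test p \<subseteq> {..<b}"
  shows "holds p \<tau> = holds p \<sigma>"
  using assms by (cases p) (auto simp: agree_def)

lemma private_part_set [simp]:
  "r < a \<Longrightarrow> private_part a b (set_wreg r v \<tau>) = private_part a b \<tau>"
  "r < b \<Longrightarrow> private_part a b (set_rreg r y \<tau>) = private_part a b \<tau>"
  "private_part a b (\<tau>\<lparr>wmem := M\<rparr>) = private_part a b \<tau>"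
  by (auto simp: private_part_def fun_eq_iff)

text \<open>
  The run being simulated has no real memory, so it never executes \<open>RLoad\<close> or \<open>RStore\<close> and the
  simulating run may use its real memory freely.
\<close>

lemma wp_map_emit:
  fixes I :: "nat list \<Rightarrow> real list \<times> (nat \<Rightarrow> nat) \<times> (nat \<Rightarrow> real) \<Rightarrow> bool"
  assumes handler: "\<And>js \<tau> r. r < a \<Longrightarrow> wreg \<tau> r < m \<Longrightarrow> I js (private_part a b \<tau>) \<Longrightarrow>
      wp w (E r) (\<lambda>k out \<tau>'. k \<le> K \<and> out = [] \<and> agree a b \<tau> \<tau>' \<and>
        I (js @ [wreg \<tau> r]) (private_part a b \<tau>')) \<tau>"
    and K: "0 < K"
  shows "exec w c \<sigma> k out \<sigma>' \<Longrightarrow> rmem \<sigma> = [] \<Longrightarrow> set out \<subseteq> {..<m} \<Longrightarrow>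
    wregs c \<subseteq> {..<a} \<Longrightarrow> rregs c \<subseteq> {..<b} \<Longrightarrow> agree a b \<sigma> \<tau> \<Longrightarrow> I js (private_part a b \<tau>) \<Longrightarrow>
    rmem \<sigma>' = [] \<and>
    wp w (map_emit E c) (\<lambda>k' out' \<tau>'. k' \<le> K * k \<and> out' = [] \<and> agree a b \<sigma>' \<tau>' \<and>
      I (js @ out) (private_part a b \<tau>')) \<tau>"
proof (induction arbitrary: \<tau> js rule: exec.induct)
  case (Emit r \<sigma>)
  then have r: "r < a" "wreg \<tau> r = wreg \<sigma> r" "wreg \<tau> r < m"
    by (auto simp: agree_def)
  have "wp w (map_emit E (Emit r)) (\<lambda>k' out' \<tau>'. k' \<le> K * 1 \<and> out' = [] \<and> agree a b \<sigma> \<tau>' \<and>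
      I (js @ [wreg \<sigma> r]) (private_part a b \<tau>')) \<tau>"
    unfolding map_emit.simps
    by (rule wp_mono[OF handler[OF r(1,3) Emit.prems(6)]])
      (use Emit.prems(5) r(2) in \<open>simp add: agree_def\<close>)
  with Emit.prems(1) show ?case by simp
next
  case (Seq c1 \<sigma> k1 out1 \<sigma>1 c2 k2 out2 \<sigma>2)
  from Seq.prems Seq.IH(1)[of \<tau> js]
  have 1: "rmem \<sigma>1 = []" "wp w (map_emit E c1) (\<lambda>k' out' \<tau>'. k' \<le> K * k1 \<and> out' = [] \<and>
      agree a b \<sigma>1 \<tau>' \<and> I (js @ out1) (private_part a b \<tau>')) \<tau>"
    by auto
  have 2: "rmem \<sigma>2 = [] \<and> wp w (map_emit E c2) (\<lambda>k' out' \<tau>''. k' \<le> K * k2 \<and> out' = [] \<and>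
      agree a b \<sigma>2 \<tau>'' \<and> I ((js @ out1) @ out2) (private_part a b \<tau>'')) \<tau>'"
    if "agree a b \<sigma>1 \<tau>'" "I (js @ out1) (private_part a b \<tau>')" for \<tau>'
    using Seq.prems Seq.IH(2)[of \<tau>' "js @ out1"] that 1(1) by auto
  \<comment> \<open>The second induction hypothesis needs a state that agrees with
    \<open>\<sigma>1\<close>; the run of the first half supplies one.\<close>
  have "rmem \<sigma>2 = []"
    using 1(2) 2 unfolding wp_def by blast
  moreover have "wp w (map_emit E (Seq c1 c2)) (\<lambda>k' out' \<tau>'. k' \<le> K * (k1 + k2) \<and> out' = [] \<and>
      agree a b \<sigma>2 \<tau>' \<and> I (js @ out1 @ out2) (private_part a b \<tau>')) \<tau>"
    unfolding map_emit.simps wp_Seq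
  proof (rule wp_mono[OF 1(2)], elim conjE)
    fix l \<tau>' and o1 :: "nat list"
    assume *: "l \<le> K * k1" "o1 = []" "agree a b \<sigma>1 \<tau>'" "I (js @ out1) (private_part a b \<tau>')"
    show "wp w (map_emit E c2) (\<lambda>k2' out2' \<tau>'. l + k2' \<le> K * (k1 + k2) \<and> o1 @ out2' = [] \<and>
      agree a b \<sigma>2 \<tau>' \<and> I (js @ out1 @ out2) (private_part a b \<tau>')) \<tau>'"
      by (rule wp_mono[OF 2[OF *(3,4), THEN conjunct2]]) (use * in \<open>auto simp: algebra_simps\<close>)
  qed
  ultimately show ?case by simp
next
  case (CondTrue p \<sigma> c1 k out \<sigma>' c2)
  then have "holds p \<tau>" using agree_holds[of a b \<sigma> \<tau> p] by auto
  with CondTrue.prems CondTrue.IH[of \<tau> js] K show ?case by (auto elim!: wp_mono)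
next
  case (CondFalse p \<sigma> c2 k out \<sigma>' c1)
  then have "\<not> holds p \<tau>" using agree_holds[of a b \<sigma> \<tau> p] by auto
  with CondFalse.prems CondFalse.IH[of \<tau> js] K show ?case by (auto elim!: wp_mono)
next
  case (WhileFalse p \<sigma> c)
  then have "\<not> holds p \<tau>" using agree_holds[of a b \<sigma> \<tau> p] by auto
  with WhileFalse K show ?case by (simp add: wp_While)
next
  case (WhileTrue p \<sigma> c k1 out1 \<sigma>1 k2 out2 \<sigma>2)
  then have p: "holds p \<tau>" using agree_holds[of a b \<sigma> \<tau> p] by auto
  from WhileTrue.prems WhileTrue.IH(1)[of \<tau> js]
  have 1: "rmem \<sigma>1 = []" "wp w (map_emit E c) (\<lambda>k' out' \<tau>'. k' \<le> K * k1 \<and> out' = [] \<and>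
      agree a b \<sigma>1 \<tau>' \<and> I (js @ out1) (private_part a b \<tau>')) \<tau>"
    by auto
  have 2: "rmem \<sigma>2 = [] \<and> wp w (map_emit E (While p c)) (\<lambda>k' out' \<tau>''. k' \<le> K * k2 \<and> out' = [] \<and>
      agree a b \<sigma>2 \<tau>'' \<and> I ((js @ out1) @ out2) (private_part a b \<tau>'')) \<tau>'"
    if "agree a b \<sigma>1 \<tau>'" "I (js @ out1) (private_part a b \<tau>')" for \<tau>'
    using WhileTrue.prems WhileTrue.IH(2)[of \<tau>' "js @ out1"] that 1(1) by auto
  have "rmem \<sigma>2 = []"
    using 1(2) 2 unfolding wp_def by blast
  moreover have "wp w (While p (map_emit E c)) (\<lambda>k' out' \<tau>'. k' \<le> K * Suc (k1 + k2) \<and> out' = [] \<and>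
      agree a b \<sigma>2 \<tau>' \<and> I (js @ out1 @ out2) (private_part a b \<tau>')) \<tau>"
  proof (subst wp_While, simp only: p if_True, rule wp_mono[OF 1(2)], elim conjE)
    fix l \<tau>' and o1 :: "nat list"
    assume *: "l \<le> K * k1" "o1 = []" "agree a b \<sigma>1 \<tau>'" "I (js @ out1) (private_part a b \<tau>')"
    show "wp w (While p (map_emit E c)) (\<lambda>k2' out2' \<tau>'. Suc (l + k2') \<le> K * Suc (k1 + k2) \<and>
      o1 @ out2' = [] \<and> agree a b \<sigma>2 \<tau>' \<and> I (js @ out1 @ out2) (private_part a b \<tau>')) \<tau>'"
      by (rule wp_mono[OF 2[OF *(3,4), THEN conjunct2, unfolded map_emit.simps]])
        (use * K in \<open>auto simp: algebra_simps\<close>)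
  qed
  ultimately show ?case by simp
qed (use K in \<open>auto simp: agree_def\<close>)

section \<open>Counters and expansion\<close>

definition bump :: "real \<Rightarrow> real list \<Rightarrow> nat \<Rightarrow> real list" where
  "bump \<Delta> ys j = ys[j := ys ! j + \<Delta>]"

lemma length_foldl_bump [simp]: "length (foldl (bump \<Delta>) ys js) = length ys"
  by (induction js arbitrary: ys) (simp_all add: bump_def)

lemma foldl_bump_nth:
  "j < length ys \<Longrightarrow> foldl (bump \<Delta>) ys js ! j = ys ! j + \<Delta> * count_list js j"
  by (induction js arbitrary: ys) (auto simp: bump_def nth_list_update algebra_simps)

text \<open>Edges are counted with multiplicity: \<open>\<Gamma> i\<close> may take a value several
  times, and each occurrence changes the counter.\<close>

definition counter :: "nat \<Rightarrow> nat \<Rightarrow> (nat \<Rightarrow> nat \<Rightarrow> nat) \<Rightarrow> (nat \<Rightarrow> real) \<Rightarrow> nat \<Rightarrow> real" where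
  "counter n D \<Gamma> x j = (\<Sum>i<n. x i * count_list (map (\<Gamma> i) [0..<D]) j)"

text \<open>Serves both linear functionals of the vector: the counters, where \<open>f\<close> is
  the multiplicity of an edge, and the sum of the coordinates, where \<open>f\<close> is 1.\<close>

lemma sum_mult_fun_upd:
  fixes x :: "nat \<Rightarrow> real"
  assumes "i < n"
  shows "(\<Sum>k<n. (x(i := x i + \<Delta>)) k * f k) = (\<Sum>k<n. x k * f k) + \<Delta> * f i"
proof -
  have "(\<Sum>k<n. (x(i := x i + \<Delta>)) k * f k) = (\<Sum>k<n. x k * f k + (if k = i then \<Delta> * f i else 0))"
    by (rule sum.cong) (auto simp: algebra_simps)
  then show ?thesis
    using assms by (simp add: sum.distrib)
qed

lemma counter_update:
  "i < n \<Longrightarrow> counter n D \<Gamma> (x(i := x i + \<Delta>)) j =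
     counter n D \<Gamma> x j + \<Delta> * count_list (map (\<Gamma> i) [0..<D]) j"
  unfolding counter_def by (rule sum_mult_fun_upd)

lemma counter_nonneg: "(\<And>i. i < n \<Longrightarrow> 0 \<le> x i) \<Longrightarrow> 0 \<le> counter n D \<Gamma> x j"
  unfolding counter_def by (intro sum_nonneg) simp

text \<open>The edge occurs at least once in the sum, and the other summands are nonnegative. Hence
  no heavy hitter misses the threshold.\<close>

lemma counter_ge:
  assumes "\<And>i. i < n \<Longrightarrow> 0 \<le> x i" and "i < n" and "d < D"
  shows "x i \<le> counter n D \<Gamma> x (\<Gamma> i d)"
proof -
  have "count_list (map (\<Gamma> i) [0..<D]) (\<Gamma> i d) \<noteq> 0"
    using assms(3) by (simp add: count_list_0_iff)
  then have "x i * 1 \<le> x i * count_list (map (\<Gamma> i) [0..<D]) (\<Gamma> i d)"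
    using assms(1,2) by (intro mult_left_mono) auto
  also have "\<dots> \<le> counter n D \<Gamma> x (\<Gamma> i d)"
    unfolding counter_def using assms(1,2)
    by (intro member_le_sum[of i "{..<n}" "\<lambda>i'. x i' * count_list (map (\<Gamma> i') [0..<D]) (\<Gamma> i d)"]) auto
  finally show ?thesis by simp
qed

text \<open>Double counting: each coordinate enters the counters once for every one of its
  \<open>D\<close> edges.\<close>

lemma sum_counter:
  assumes "bipartite_graph n D m \<Gamma>"
  shows "(\<Sum>j<m. counter n D \<Gamma> x j) = real D * (\<Sum>i<n. x i)"
proof -
  have *: "(\<Sum>j<m. real (count_list (map (\<Gamma> i) [0..<D]) j)) = real D" if "i < n" for i
  proof -
    have "(\<Sum>j<m. count_list (map (\<Gamma> i) [0..<D]) j) = length (map (\<Gamma> i) [0..<D])"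
      by (rule sum_count_set) (use assms that in \<open>auto simp: bipartite_graph_def\<close>)
    then show ?thesis by (simp flip: of_nat_sum)
  qed
  have "(\<Sum>j<m. counter n D \<Gamma> x j) =
      (\<Sum>i<n. x i * (\<Sum>j<m. real (count_list (map (\<Gamma> i) [0..<D]) j)))"
    unfolding counter_def by (subst sum.swap) (simp add: sum_distrib_left)
  also have "\<dots> = real D * (\<Sum>i<n. x i)"
    by (simp add: * sum_distrib_left mult.commute)
  finally show ?thesis .
qed

lemma card_neighbours_mult_le:
  assumes "bipartite_graph n D m \<Gamma>" and "\<And>i. i < n \<Longrightarrow> 0 \<le> x i" and "T \<subseteq> {..<n}"
    and "\<And>i d. i \<in> T \<Longrightarrow> d < D \<Longrightarrow> \<theta> \<le> counter n D \<Gamma> x (\<Gamma> i d)"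
  shows "real (card (neighbours D \<Gamma> T)) * \<theta> \<le> real D * (\<Sum>i<n. x i)"
proof -
  have "neighbours D \<Gamma> T \<subseteq> {..<m}"
    using assms(1,3) by (auto simp: neighbours_def bipartite_graph_def)
  moreover have "real (card (neighbours D \<Gamma> T)) * \<theta> \<le> (\<Sum>j\<in>neighbours D \<Gamma> T. counter n D \<Gamma> x j)"
    by (rule sum_bounded_below) (auto simp: neighbours_def assms(4))
  ultimately show ?thesis
    using sum_mono2[of "{..<m}" "neighbours D \<Gamma> T" "counter n D \<Gamma> x"] counter_nonneg[OF assms(2)]
    by (simp add: sum_counter[OF assms(1)])
qed

text \<open>Expansion is available only up to \<open>c / \<epsilon>\<close> vertices, so a set of
  reported vertices that is too large is first cut down to an admissible \<open>T\<close>.\<close>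

lemma card_heavy_counters_le:
  fixes \<zeta> c \<epsilon> :: real
  assumes graph: "bipartite_graph n D m \<Gamma>" and exp: "expanding n D \<Gamma> (c / \<epsilon>) \<zeta>" and "0 < D"
    and "\<zeta> < 1" "2 / (1 - \<zeta>) < c" "0 < \<epsilon>" "\<epsilon> \<le> c"
    and x: "\<And>i. i < n \<Longrightarrow> 0 \<le> x i" and pos: "0 < (\<Sum>i<n. x i)"
  shows "real (card {i. i < n \<and> (\<forall>d<D. \<epsilon> * (\<Sum>i<n. x i) \<le> counter n D \<Gamma> x (\<Gamma> i d))}) \<le> c / \<epsilon>"
    (is "real (card ?S) \<le> _")
proof (rule ccontr)
  assume "\<not> real (card ?S) \<le> c / \<epsilon>"
  define q where "q = nat \<lfloor>c / \<epsilon>\<rfloor>"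
  have "1 \<le> c / \<epsilon>" using assms by simp
  then have "1 \<le> \<lfloor>c / \<epsilon>\<rfloor>" by simp
  then have "1 \<le> real q" "real q = of_int \<lfloor>c / \<epsilon>\<rfloor>" unfolding q_def by simp_all
  \<comment> \<open>As \<open>c / \<epsilon>\<close> is at least 1, rounding it down loses less than
    a factor of 2; the 2 in \<open>2 / (1 - \<zeta>) < c\<close> pays for this.\<close>
  then have q: "real q \<le> c / \<epsilon>" "c / \<epsilon> < 2 * real q"
    using floor_correct[of "c / \<epsilon>"] by linarith+
  with \<open>\<not> real (card ?S) \<le> c / \<epsilon>\<close> have "q \<le> card ?S" by linarith
  then obtain T where T: "T \<subseteq> ?S" "card T = q" by (meson obtain_subset_with_card_n)
  then have "T \<subseteq> {..<n}" by auto
  have "(1 - \<zeta>) * real q * real D \<le> real (card (neighbours D \<Gamma> T))"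
    using exp \<open>T \<subseteq> {..<n}\<close> T(2) q(1) unfolding expanding_def by auto
  then have "(1 - \<zeta>) * real q * real D * (\<epsilon> * (\<Sum>i<n. x i)) \<le>
      real (card (neighbours D \<Gamma> T)) * (\<epsilon> * (\<Sum>i<n. x i))"
    using pos \<open>0 < \<epsilon>\<close> by (intro mult_right_mono) auto
  also have "\<dots> \<le> real D * (\<Sum>i<n. x i)"
    by (rule card_neighbours_mult_le[OF graph x \<open>T \<subseteq> {..<n}\<close>]) (use T in auto)
  finally have "((1 - \<zeta>) * real q * \<epsilon>) * (real D * (\<Sum>i<n. x i)) \<le> 1 * (real D * (\<Sum>i<n. x i))"
    by (simp add: mult_ac)
  then have "(1 - \<zeta>) * (real q * \<epsilon>) \<le> 1"
    using pos \<open>0 < D\<close> by (simp add: mult_le_cancel_right mult.assoc)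
  \<comment> \<open>This fact and the next put \<open>(1 - \<zeta>) * (real q * \<epsilon>)\<close>
    above 1.\<close>
  moreover have "(1 - \<zeta>) * c < (1 - \<zeta>) * (2 * (real q * \<epsilon>))"
    using q(2) \<open>0 < \<epsilon>\<close> \<open>\<zeta> < 1\<close> by (intro mult_strict_left_mono) (simp_all add: field_simps)
  moreover have "2 < (1 - \<zeta>) * c"
    using \<open>2 / (1 - \<zeta>) < c\<close> \<open>\<zeta> < 1\<close> by (simp add: field_simps)
  ultimately show False by linarith
qed

section \<open>Streams and their prefixes\<close>

lemma stream_vector_snoc:
  "stream_vector (us @ [(i, \<Delta>)]) = (stream_vector us)(i := stream_vector us i + \<Delta>)"
  by (simp add: stream_vector_def)

lemma strict_turnstile_snocD:
  assumes "strict_turnstile n (us @ [(i, \<Delta>)])"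
  shows "strict_turnstile n us" "i < n"
proof -
  show "i < n" using assms by (auto simp: strict_turnstile_def)
  have "0 \<le> stream_vector (take k us) j" if "k \<le> length us" "j < n" for k j
    using assms that unfolding strict_turnstile_def
    by (elim conjE allE[of _ k]) simp
  then show "strict_turnstile n us"
    using assms by (auto simp: strict_turnstile_def)
qed

lemma strict_turnstile_nonneg: "strict_turnstile n us \<Longrightarrow> i < n \<Longrightarrow> 0 \<le> stream_vector us i"
  unfolding strict_turnstile_def by (metis le_refl take_all)

section \<open>The algorithm\<close>

text \<open>
  \<open>P\<close> uses word registers below \<open>a\<close> and real registers below \<open>b\<close>. Word register \<open>a\<close> holds \<open>0\<close>, \<open>a + 1\<close>
  holds \<open>1\<close>, \<open>a + 2\<close> holds \<open>n\<close>, \<open>a + 3\<close> the current vertex, \<open>a + 4\<close> whether all its counters seen so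
  far reach the threshold. Real register \<open>b\<close> holds the \<open>\<ell>\<^sub>1\<close> norm, \<open>b + 1\<close> the increment or the threshold.
\<close>

definition add_handler :: "nat \<Rightarrow> nat \<Rightarrow> com" where
  "add_handler b r =
     Seq (RLoad (b + 2) r) (Seq (ROp (b + 2) RAdd (b + 2) (b + 1)) (RStore r (b + 2)))"

text \<open>No instruction copies a real, so the zero in \<open>b + 4\<close> is added instead. The
  copy precedes \<open>P\<close>, which may overwrite register 0.\<close>

definition update_prog :: "nat \<Rightarrow> com \<Rightarrow> com" where
  "update_prog b P =
     Seq (RConst (b + 4) 0) (Seq (ROp (b + 1) RAdd 0 (b + 4)) (Seq (ROp b RAdd b 0)
       (map_emit (add_handler b) P)))"

text \<open>The flag is only ever lowered, so it ends as the conjunction of the tests of all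
  neighbours.\<close>

definition test_handler :: "nat \<Rightarrow> nat \<Rightarrow> nat \<Rightarrow> com" where
  "test_handler a b r =
     Seq (RLoad (b + 2) r) (Cond (RLess (b + 2) (b + 1)) (WConst (a + 4) 0) Skip)"

text \<open>Register 0 is loaded anew for every vertex, because \<open>P\<close> may destroy it;
  register \<open>a\<close> holds 0, so the addition is a copy.\<close>

definition query_body :: "nat \<Rightarrow> nat \<Rightarrow> com \<Rightarrow> com" where
  "query_body a b P =
     Seq (WOp 0 WAdd (a + 3) a) (Seq (WConst (a + 4) 1) (Seq (map_emit (test_handler a b) P)
       (Seq (Cond (WEq (a + 4) (a + 1)) (Emit (a + 3)) Skip) (WOp (a + 3) WAdd (a + 3) (a + 1)))))"

definition query_loop :: "nat \<Rightarrow> nat \<Rightarrow> com \<Rightarrow> com" where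
  "query_loop a b P = While (WLess (a + 3) (a + 2)) (query_body a b P)"

text \<open>Apart from the norm, every private register is set before it is read, so nothing is
  assumed about values left by earlier operations.\<close>

definition query_prog :: "nat \<Rightarrow> nat \<Rightarrow> com \<Rightarrow> com" where
  "query_prog a b P =
     Seq (WConst a 0) (Seq (WConst (a + 1) 1) (Seq (WOp (a + 2) WAdd 0 a) (Seq (WConst (a + 3) 0)
     (Seq (ROp (b + 1) RMul 0 b) (Seq (RConst (b + 3) 1) (Seq (RConst (b + 4) 0)
     (Cond (RLess (b + 3) 0) Skip (Cond (RLess (b + 4) b) (query_loop a b P) Skip))))))))"

text \<open>At most six word and six real registers are new; register 0 counts among them because
  \<open>P\<close> need not mention it.\<close>

lemma register_count_update_query:
  "register_count {update_prog b P, query_prog a b P} \<le> register_count {P} + 12"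
proof -
  have "wregs (map_emit (add_handler b) P) \<subseteq> wregs P \<union> {}"
    by (rule wregs_map_emit) (simp add: add_handler_def)
  moreover have "wregs (map_emit (test_handler a b) P) \<subseteq> wregs P \<union> {a + 4}"
    by (rule wregs_map_emit) (auto simp: test_handler_def)
  ultimately have w: "wregs (update_prog b P) \<union> wregs (query_prog a b P) \<subseteq>
      wregs P \<union> set [0, a, a + 1, a + 2, a + 3, a + 4]"
    unfolding update_prog_def query_prog_def query_loop_def query_body_def by auto
  have "rregs (map_emit (add_handler b) P) \<subseteq> rregs P \<union> {b + 1, b + 2}"
    by (rule rregs_map_emit) (auto simp: add_handler_def)
  moreover have "rregs (map_emit (test_handler a b) P) \<subseteq> rregs P \<union> {b + 1, b + 2}"
    by (rule rregs_map_emit) (auto simp: test_handler_def)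
  ultimately have r: "rregs (update_prog b P) \<union> rregs (query_prog a b P) \<subseteq>
      rregs P \<union> set [0, b, b + 1, b + 2, b + 3, b + 4]"
    unfolding update_prog_def query_prog_def query_loop_def query_body_def by auto
  have bound: "card X \<le> card Y + 6" if "X \<subseteq> Y \<union> set ks" "finite Y" "length ks = 6"
    for X Y :: "nat set" and ks
    using card_mono[OF _ that(1)] card_Un_le[of Y "set ks"] card_length[of ks] that(2,3) by simp
  show ?thesis
    using bound[OF w finite_wregs] bound[OF r finite_rregs] by (simp add: register_count_def)
qed

text \<open>Positive \<open>a\<close> and \<open>b\<close> keep the argument registers 0 out of the
  private range. The bound on \<open>n\<close> stops the loop counter from wrapping around.\<close>

locale stored_graph =
  fixes w n m D s t a b :: nat and P :: com and R :: "nat list set" and \<Gamma> :: "nat \<Rightarrow> nat \<Rightarrow> nat"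
  assumes n_pos: "0 < n" and n_less: "n < 2 ^ w"
    and graph: "bipartite_graph n D m \<Gamma>"
    and stores: "stores_graph w P R n D \<Gamma> s t"
    and a_pos: "0 < a" and b_pos: "0 < b"
    and wregs_P: "wregs P \<subseteq> {..<a}" and rregs_P: "rregs P \<subseteq> {..<b}"
begin

lemma w_pos [simp]: "0 < w"
  using n_pos n_less by (cases w) simp_all

text \<open>\<open>stores_graph\<close> covers only states without real memory. Erasing that memory
  gives such a state, and \<open>wp_map_emit\<close> carries its run back to
  \<open>\<tau>\<close>.\<close>

lemma wp_neighbours:
  assumes handler: "\<And>js \<tau> r. r < a \<Longrightarrow> wreg \<tau> r < m \<Longrightarrow> I js (private_part a b \<tau>) \<Longrightarrow>
      wp w (E r) (\<lambda>k out \<tau>'. k \<le> K \<and> out = [] \<and> agree a b \<tau> \<tau>' \<and>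
        I (js @ [wreg \<tau> r]) (private_part a b \<tau>')) \<tau>"
    and "0 < K" and "i < n" "valid_words w \<tau>" "wmem \<tau> \<in> R" "wreg \<tau> 0 = i" "I [] (private_part a b \<tau>)"
  shows "wp w (map_emit E P) (\<lambda>k out \<tau>'. k \<le> K * t \<and> out = [] \<and> valid_words w \<tau>' \<and> wmem \<tau>' \<in> R \<and>
      I (map (\<Gamma> i) [0..<D]) (private_part a b \<tau>')) \<tau>"
proof -
  let ?\<sigma> = "\<tau>\<lparr>rmem := []\<rparr>"
  have "valid_words w ?\<sigma>" "wmem ?\<sigma> \<in> R" "rmem ?\<sigma> = []" "wreg ?\<sigma> 0 = i"
    using assms by (auto simp: valid_words_def)
  then obtain k \<sigma>' where *: "exec w P ?\<sigma> k (map (\<Gamma> i) [0..<D]) \<sigma>'" "k \<le> t" "wmem \<sigma>' \<in> R"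
    using stores \<open>i < n\<close> unfolding stores_graph_def by blast
  have "set (map (\<Gamma> i) [0..<D]) \<subseteq> {..<m}"
    using graph \<open>i < n\<close> by (auto simp: bipartite_graph_def)
  moreover have "agree a b ?\<sigma> \<tau>" "rmem ?\<sigma> = []" by (simp_all add: agree_def)
  ultimately have "wp w (map_emit E P) (\<lambda>k' out' \<tau>'. k' \<le> K * k \<and> out' = [] \<and> agree a b \<sigma>' \<tau>' \<and>
      I ([] @ map (\<Gamma> i) [0..<D]) (private_part a b \<tau>')) \<tau>"
    using wp_map_emit[where I = I and m = m, OF handler \<open>0 < K\<close> *(1)] wregs_P rregs_P assms(7)
    by blast
  then show ?thesis
  proof (rule wp_mono, elim conjE)
    fix k' out' \<tau>'
    assume "exec w (map_emit E P) \<tau> k' out' \<tau>'" "k' \<le> K * k" "out' = []" "agree a b \<sigma>' \<tau>'"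
      "I ([] @ map (\<Gamma> i) [0..<D]) (private_part a b \<tau>')"
    moreover from this(2) have "k' \<le> K * t" using *(2) by (rule le_trans[OF _ mult_le_mono2])
    moreover from calculation(1) have "valid_words w \<tau>'" using assms(4) by (rule exec_valid_words)
    ultimately show "k' \<le> K * t \<and> out' = [] \<and> valid_words w \<tau>' \<and> wmem \<tau>' \<in> R \<and>
      I (map (\<Gamma> i) [0..<D]) (private_part a b \<tau>')"
      using *(3) by (simp add: agree_def)
  qed
qed

text \<open>There is a vertex to ask for, and every run has at least one step. This lets constant
  overheads be charged to \<open>t\<close>.\<close>

lemma t_pos: "0 < t"
proof -
  obtain M where M: "M \<in> R" "\<forall>v\<in>set M. v < 2 ^ w"
    using stores unfolding stores_graph_def by blast
  let ?\<sigma> = "init_state M 0"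
  have "valid_words w ?\<sigma>" "wmem ?\<sigma> \<in> R" "rmem ?\<sigma> = []" "wreg ?\<sigma> 0 = 0"
    using M by (auto simp: valid_words_def init_state_def)
  then obtain k out \<sigma>' where "exec w P ?\<sigma> k out \<sigma>'" "k \<le> t"
    using stores n_pos unfolding stores_graph_def by blast
  moreover have "exec w c \<sigma> k out \<sigma>' \<Longrightarrow> 0 < k" for c \<sigma> k out \<sigma>'
    by (induction rule: exec.induct) auto
  ultimately show ?thesis by (meson less_le_trans)
qed

section \<open>The invariant between operations and the update\<close>

text \<open>Real register \<open>b\<close> holds the plain sum, which is the norm as long as the
  coordinates are nonnegative. Apart from the range of words, the other registers are
  unconstrained.\<close>

definition sketch :: "(nat \<Rightarrow> real) \<Rightarrow> state \<Rightarrow> bool" where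
  "sketch x \<sigma> \<longleftrightarrow> valid_words w \<sigma> \<and> wmem \<sigma> \<in> R \<and>
     rmem \<sigma> = map (counter n D \<Gamma> x) [0..<m] \<and> rreg \<sigma> b = (\<Sum>i<n. x i)"

lemma wp_update:
  assumes "sketch x \<sigma>" and "i < n"
  shows "wp w (update_prog b P) (\<lambda>k out \<sigma>'. k \<le> 6 * t \<and> sketch (x(i := x i + \<Delta>)) \<sigma>') (call i \<Delta> \<sigma>)"
proof -
  let ?ys = "map (counter n D \<Gamma> x) [0..<m]" and ?L = "(\<Sum>i<n. x i) + \<Delta>"
  \<comment> \<open>After the neighbours \<open>js\<close>, the counters are the old ones bumped
    along \<open>js\<close>; the norm is already updated.\<close>
  define I :: "nat list \<Rightarrow> real list \<times> (nat \<Rightarrow> nat) \<times> (nat \<Rightarrow> real) \<Rightarrow> bool" where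
    "I = (\<lambda>js (ys, ws, rs). ys = foldl (bump \<Delta>) ?ys js \<and> rs 0 = ?L \<and> rs 1 = \<Delta>)"
  let ?\<tau> = "set_rreg b ?L (set_rreg (b + 1) \<Delta> (set_rreg (b + 4) 0 (call i \<Delta> \<sigma>)))"
  have "foldl (bump \<Delta>) ?ys (map (\<Gamma> i) [0..<D]) = map (counter n D \<Gamma> (x(i := x i + \<Delta>))) [0..<m]"
    by (rule nth_equalityI) (simp_all add: foldl_bump_nth counter_update \<open>i < n\<close>)
  moreover have "(\<Sum>k<n. (x(i := x i + \<Delta>)) k) = ?L"
    using sum_mult_fun_upd[OF \<open>i < n\<close>, of x \<Delta> "\<lambda>_. 1"] by simp
  moreover have "wp w (map_emit (add_handler b) P) (\<lambda>k out \<tau>'. k \<le> 3 * t \<and> out = [] \<and>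
      valid_words w \<tau>' \<and> wmem \<tau>' \<in> R \<and> I (map (\<Gamma> i) [0..<D]) (private_part a b \<tau>')) ?\<tau>"
  proof (rule wp_neighbours)
    show "wp w (add_handler b r) (\<lambda>k out \<tau>'. k \<le> 3 \<and> out = [] \<and> agree a b \<tau> \<tau>' \<and>
        I (js @ [wreg \<tau> r]) (private_part a b \<tau>')) \<tau>"
      if "r < a" "wreg \<tau> r < m" "I js (private_part a b \<tau>)" for js \<tau> r
      using that by (simp add: add_handler_def I_def private_part_def agree_def bump_def)
    show "valid_words w ?\<tau>"
      using assms n_less by (simp add: sketch_def call_def valid_words_set_wreg)
    show "I [] (private_part a b ?\<tau>)" "wreg ?\<tau> 0 = i" "wmem ?\<tau> \<in> R"
      using assms by (simp_all add: sketch_def I_def private_part_def)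
  qed (use assms in simp_all)
  \<comment> \<open>Three instructions precede the call, and \<open>3 * t + 3 \<le> 6 * t\<close>
    because \<open>t\<close> is positive.\<close>
  ultimately have "wp w (map_emit (add_handler b) P) (\<lambda>k out \<tau>'. Suc (Suc (Suc k)) \<le> 6 * t \<and>
      sketch (x(i := x i + \<Delta>)) \<tau>') ?\<tau>"
    using t_pos by (auto elim!: wp_mono simp: sketch_def I_def private_part_def simp del: fun_upd_apply)
  moreover have "rreg \<sigma> b = (\<Sum>i<n. x i)" using assms by (simp add: sketch_def)
  ultimately show ?thesis
    using b_pos by (simp add: update_prog_def)
qed

section \<open>The query\<close>

definition query_inv :: "(nat \<Rightarrow> real) \<Rightarrow> real \<Rightarrow> nat \<Rightarrow> state \<Rightarrow> bool" where
  "query_inv x \<theta> i \<tau> \<longleftrightarrow> sketch x \<tau> \<and> wreg \<tau> a = 0 \<and> wreg \<tau> (a + 1) = 1 \<and> wreg \<tau> (a + 2) = n \<and>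
     wreg \<tau> (a + 3) = i \<and> rreg \<tau> (b + 1) = \<theta>"

definition all_counters_ge :: "(nat \<Rightarrow> real) \<Rightarrow> real \<Rightarrow> nat \<Rightarrow> bool" where
  "all_counters_ge x \<theta> i \<longleftrightarrow> (\<forall>d<D. \<theta> \<le> counter n D \<Gamma> x (\<Gamma> i d))"

lemma wp_query_body:
  assumes "query_inv x \<theta> i \<tau>" and "i < n"
  shows "wp w (query_body a b P) (\<lambda>k out \<tau>'. k \<le> 3 * t + 5 \<and>
      out = filter (all_counters_ge x \<theta>) [i] \<and> query_inv x \<theta> (Suc i) \<tau>') \<tau>"
proof -
  let ?ys = "map (counter n D \<Gamma> x) [0..<m]"
  \<comment> \<open>\<open>ws 4\<close> is the flag: it is 1 as long as all neighbours in
    \<open>js\<close> pass.\<close>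
  define I :: "nat list \<Rightarrow> real list \<times> (nat \<Rightarrow> nat) \<times> (nat \<Rightarrow> real) \<Rightarrow> bool" where
    "I = (\<lambda>js (ys, ws, rs). ys = ?ys \<and> rs 0 = (\<Sum>i<n. x i) \<and> rs 1 = \<theta> \<and>
       ws 0 = 0 \<and> ws 1 = 1 \<and> ws 2 = n \<and> ws 3 = i \<and>
       ws 4 = (if \<forall>j\<in>set js. \<theta> \<le> counter n D \<Gamma> x j then 1 else 0))"
  let ?\<tau> = "set_wreg (a + 4) 1 (set_wreg 0 i \<tau>)"
  have i: "i mod 2 ^ w = i" "Suc i mod 2 ^ w = Suc i"
    using assms n_less by simp_all
  have "wp w (map_emit (test_handler a b) P) (\<lambda>k out \<tau>'. k \<le> 3 * t \<and> out = [] \<and>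
      valid_words w \<tau>' \<and> wmem \<tau>' \<in> R \<and> I (map (\<Gamma> i) [0..<D]) (private_part a b \<tau>')) ?\<tau>"
  proof (rule wp_neighbours)
    show "wp w (test_handler a b r) (\<lambda>k out \<tau>'. k \<le> 3 \<and> out = [] \<and> agree a b \<tau> \<tau>' \<and>
        I (js @ [wreg \<tau> r]) (private_part a b \<tau>')) \<tau>"
      if "r < a" "wreg \<tau> r < m" "I js (private_part a b \<tau>)" for js \<tau> r
      using that by (auto simp: test_handler_def I_def private_part_def agree_def)
    show "valid_words w ?\<tau>"
      using assms n_less by (simp add: query_inv_def sketch_def valid_words_set_wreg)
    show "I [] (private_part a b ?\<tau>)" "wreg ?\<tau> 0 = i" "wmem ?\<tau> \<in> R"
      using assms a_pos by (simp_all add: query_inv_def sketch_def I_def private_part_def)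
  qed (use assms in simp_all)
  then have *: "wp w (map_emit (test_handler a b) P) (\<lambda>k out \<tau>'. k \<le> 3 * t \<and> out = [] \<and>
      query_inv x \<theta> i \<tau>' \<and> wreg \<tau>' (a + 4) = (if all_counters_ge x \<theta> i then 1 else 0)) ?\<tau>"
    by (rule wp_mono)
      (auto simp: I_def private_part_def query_inv_def sketch_def all_counters_ge_def atLeast0LessThan)
  \<comment> \<open>Peeling off the two leading instructions for an arbitrary postcondition leaves
    the call to \<open>P\<close> in front, where its specification applies.\<close>
  have body: "wp w (query_body a b P) F \<tau> = wp w (map_emit (test_handler a b) P) (\<lambda>k out \<tau>'.
      wp w (Seq (Cond (WEq (a + 4) (a + 1)) (Emit (a + 3)) Skip) (WOp (a + 3) WAdd (a + 3) (a + 1)))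
      (\<lambda>k' out'. F (2 + (k + k')) (out @ out')) \<tau>') ?\<tau>" for F
    using assms a_pos by (simp add: query_body_def query_inv_def i)
  from * have "wp w (map_emit (test_handler a b) P) (\<lambda>k out \<tau>'.
      wp w (Seq (Cond (WEq (a + 4) (a + 1)) (Emit (a + 3)) Skip) (WOp (a + 3) WAdd (a + 3) (a + 1)))
      (\<lambda>k' out' \<tau>''. 2 + (k + k') \<le> 3 * t + 5 \<and> out @ out' = filter (all_counters_ge x \<theta>) [i] \<and>
         query_inv x \<theta> (Suc i) \<tau>'') \<tau>') ?\<tau>"
    by (rule wp_mono)
      (use assms n_less in \<open>auto simp: i query_inv_def sketch_def valid_words_set_wreg split: if_splits\<close>)
  then show ?thesis unfolding body .
qed

text \<open>Each vertex costs one test and at most \<open>3 * t + 5\<close> steps; the final 1 is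
  the failing test.\<close>

lemma wp_query_loop:
  assumes "query_inv x \<theta> i \<tau>" and "i \<le> n"
  shows "wp w (query_loop a b P) (\<lambda>k out \<tau>'. k \<le> (n - i) * (3 * t + 6) + 1 \<and>
      out = filter (all_counters_ge x \<theta>) [i..<n] \<and> sketch x \<tau>') \<tau>"
  using assms
proof (induction "n - i" arbitrary: i \<tau>)
  case 0
  then have "i = n" by simp
  with 0 have "\<not> holds (WLess (a + 3) (a + 2)) \<tau>" "sketch x \<tau>"
    unfolding query_inv_def by auto
  with \<open>i = n\<close> show ?case
    unfolding query_loop_def by (subst wp_While) simp
next
  case (Suc l)
  then have "i < n" by simp
  then have "holds (WLess (a + 3) (a + 2)) \<tau>"
    using Suc.prems by (simp add: query_inv_def)
  moreover have "wp w (query_body a b P) (\<lambda>k1 out1 \<sigma>1. wp w (query_loop a b P) (\<lambda>k2 out2 \<tau>'.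
      Suc (k1 + k2) \<le> (n - i) * (3 * t + 6) + 1 \<and>
      out1 @ out2 = filter (all_counters_ge x \<theta>) [i..<n] \<and> sketch x \<tau>') \<sigma>1) \<tau>"
  proof (rule wp_mono[OF wp_query_body[OF Suc.prems(1) \<open>i < n\<close>]], elim conjE)
    fix k1 out1 \<sigma>1
    assume *: "k1 \<le> 3 * t + 5" "out1 = filter (all_counters_ge x \<theta>) [i]" "query_inv x \<theta> (Suc i) \<sigma>1"
    have ni: "n - i = Suc (n - Suc i)" "[i..<n] = i # [Suc i..<n]"
      using \<open>i < n\<close> by (simp_all add: upt_conv_Cons)
    show "wp w (query_loop a b P) (\<lambda>k2 out2 \<tau>'.
      Suc (k1 + k2) \<le> (n - i) * (3 * t + 6) + 1 \<and>
      out1 @ out2 = filter (all_counters_ge x \<theta>) [i..<n] \<and> sketch x \<tau>') \<sigma>1"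
      by (rule wp_mono[OF Suc.hyps(1)[of "Suc i" \<sigma>1]])
        (use Suc.hyps(2) * \<open>i < n\<close> in \<open>auto simp: ni\<close>)
  qed
  ultimately show ?case
    unfolding query_loop_def by (subst wp_While) simp
qed

lemma wp_query:
  assumes "sketch x \<sigma>"
  shows "wp w (query_prog a b P) (\<lambda>k out \<sigma>'. k \<le> 19 * (n * t) \<and>
      out = (if \<epsilon> \<le> 1 \<and> 0 < (\<Sum>i<n. x i)
             then filter (all_counters_ge x (\<epsilon> * (\<Sum>i<n. x i))) [0..<n] else []) \<and>
      sketch x \<sigma>') (call n \<epsilon> \<sigma>)"
proof -
  let ?L = "\<Sum>i<n. x i"
  let ?\<tau> = "set_rreg (b + 4) 0 (set_rreg (b + 3) 1 (set_rreg (b + 1) (\<epsilon> * ?L)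
    (set_wreg (a + 3) 0 (set_wreg (a + 2) n (set_wreg (a + 1) 1 (set_wreg a 0 (call n \<epsilon> \<sigma>)))))))"
  have L: "rreg \<sigma> b = ?L" using assms by (simp add: sketch_def)
  have "1 \<le> n * t" using n_pos t_pos by simp
  \<comment> \<open>The 10 are seven assignments, two tests and the failing loop test; with
    \<open>n\<close> and \<open>t\<close> positive, 3 + 6 + 10 = 19.\<close>
  moreover have "n * (3 * t + 6) + 10 \<le> 19 * (n * t)"
  proof -
    have "n \<le> n * t" using t_pos by simp
    moreover have "n * (3 * t + 6) = 3 * (n * t) + 6 * n" by (simp add: algebra_simps)
    ultimately show ?thesis using \<open>1 \<le> n * t\<close> by linarith
  qed
  moreover have inv: "query_inv x (\<epsilon> * ?L) 0 ?\<tau>"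
    using assms n_less n_pos b_pos by (simp add: query_inv_def sketch_def call_def valid_words_set_wreg)
  then have "sketch x ?\<tau>" by (simp add: query_inv_def)
  moreover have "wp w (query_loop a b P) (\<lambda>k out \<tau>'. k \<le> n * (3 * t + 6) + 1 \<and>
      out = filter (all_counters_ge x (\<epsilon> * ?L)) [0..<n] \<and> sketch x \<tau>') ?\<tau>"
    using wp_query_loop[OF inv] by simp
  ultimately show ?thesis
    using a_pos b_pos n_less
    by (auto simp: query_prog_def L elim!: wp_mono)
qed

section \<open>Correctness along whole streams\<close>

text \<open>Updates and queries may be interleaved, so each must preserve \<open>sketch\<close>; a
  query leaves the vector as it is.\<close>

lemma reachable_sketch:
  "reachable w (update_prog b P) (query_prog a b P) n \<epsilon> \<sigma>0 us \<sigma> \<Longrightarrow> strict_turnstile n us \<Longrightarrow>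
     sketch (\<lambda>_. 0) \<sigma>0 \<Longrightarrow> sketch (stream_vector us) \<sigma>"
proof (induction rule: reachable.induct)
  case init
  then show ?case by (simp add: stream_vector_def)
next
  case (update us \<sigma> i \<Delta> k out \<sigma>')
  then show ?case
    using strict_turnstile_snocD[of n us i \<Delta>] wp_exec[OF wp_update update.hyps(2)]
    unfolding stream_vector_snoc by blast
next
  case (query us \<sigma> k out \<sigma>')
  then show ?case using wp_exec[OF wp_query query.hyps(2)] by simp
qed

lemma sketch_init: "M \<in> R \<Longrightarrow> sketch (\<lambda>_. 0) (init_state M m)"
  using stores
  by (auto simp: sketch_def init_state_def valid_words_def stores_graph_def counter_def
      intro!: nth_equalityI)

lemma finds_heavy_hitters_update_query:
  fixes \<zeta> c \<epsilon> :: real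
  assumes exp: "expanding n D \<Gamma> (c / \<epsilon>) \<zeta>" and "0 < D" "0 \<le> \<zeta>" "\<zeta> < 1" "2 / (1 - \<zeta>) < c" "0 < \<epsilon>"
    and C: "19 \<le> C" "c \<le> real C" and M: "M \<in> R"
  shows "finds_heavy_hitters w (update_prog b P) (query_prog a b P) (init_state M m) n \<epsilon>
    (m + s) (C * t) (C * (n * t)) (C / \<epsilon>)"
  unfolding finds_heavy_hitters_def
proof (intro allI impI, elim conjE)
  fix us \<sigma>
  assume us: "strict_turnstile n us"
    and reach: "reachable w (update_prog b P) (query_prog a b P) n \<epsilon> (init_state M m) us \<sigma>"
  let ?x = "stream_vector us"
  let ?L = "\<Sum>i<n. ?x i"
  let ?S = "filter (all_counters_ge ?x (\<epsilon> * ?L)) [0..<n]"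
  have x: "0 \<le> ?x i" if "i < n" for i
    using strict_turnstile_nonneg[OF us that] .
  have L: "l1_norm n ?x = ?L"
    unfolding l1_norm_def by (rule sum.cong) (auto simp: x)
  have sketch: "sketch ?x \<sigma>"
    using reachable_sketch[OF reach us sketch_init[OF M]] .
  have "space \<sigma> \<le> m + s"
    using sketch stores by (auto simp: space_def sketch_def stores_graph_def)
  moreover have "\<exists>k out \<sigma>'. exec w (update_prog b P) (call i \<Delta> \<sigma>) k out \<sigma>' \<and> k \<le> C * t"
    if "strict_turnstile n (us @ [(i, \<Delta>)])" for i \<Delta>
  proof -
    have "6 * t \<le> C * t" using C by (intro mult_right_mono) auto
    then show ?thesis
      using wp_update[OF sketch strict_turnstile_snocD(2)[OF that], of \<Delta>]
      unfolding wp_def by (meson le_trans)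
  qed
  moreover have "\<exists>k out \<sigma>'. exec w (query_prog a b P) (call n \<epsilon> \<sigma>) k out \<sigma>' \<and> k \<le> C * (n * t) \<and>
      set out \<subseteq> {..<n} \<and> real (length out) \<le> C / \<epsilon> \<and>
      ((\<exists>i<n. ?x i \<noteq> 0) \<longrightarrow> heavy_hitters n \<epsilon> ?x \<subseteq> set out)"
  proof -
    obtain k out \<sigma>' where run: "exec w (query_prog a b P) (call n \<epsilon> \<sigma>) k out \<sigma>'" "k \<le> 19 * (n * t)"
      and out: "out = (if \<epsilon> \<le> 1 \<and> 0 < ?L then ?S else [])"
      using wp_query[OF sketch, of \<epsilon>] unfolding wp_def by blast
    have "19 * (n * t) \<le> C * (n * t)" using C by (intro mult_right_mono) auto
    with run(2) have "k \<le> C * (n * t)" by (rule le_trans)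
    moreover have "set out \<subseteq> {..<n}" by (auto simp: out)
    moreover have "real (length out) \<le> C / \<epsilon>"
    proof (cases "\<epsilon> \<le> 1 \<and> 0 < ?L")
      case True
      have "length ?S = card (set ?S)"
        by (rule distinct_card[symmetric]) simp
      also have "set ?S = {i. i < n \<and> (\<forall>d<D. \<epsilon> * ?L \<le> counter n D \<Gamma> ?x (\<Gamma> i d))}"
        by (auto simp: all_counters_ge_def)
      finally have len: "length ?S = card {i. i < n \<and> (\<forall>d<D. \<epsilon> * ?L \<le> counter n D \<Gamma> ?x (\<Gamma> i d))}" .
      \<comment> \<open>Nonnegative \<open>\<zeta>\<close> gives \<open>c > 2\<close>, so the guard
        \<open>\<epsilon> \<le> 1\<close> yields \<open>\<epsilon> \<le> c\<close>, as the counting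
        bound requires.\<close>
      have "2 \<le> 2 / (1 - \<zeta>)"
        using \<open>0 \<le> \<zeta>\<close> \<open>\<zeta> < 1\<close> by (simp add: field_simps)
      then have "\<epsilon> \<le> c" using True \<open>2 / (1 - \<zeta>) < c\<close> by linarith
      then have "real (length ?S) \<le> c / \<epsilon>"
        unfolding len using True assms x by (intro card_heavy_counters_le[OF graph exp]) auto
      also have "\<dots> \<le> C / \<epsilon>" using C \<open>0 < \<epsilon>\<close> by (simp add: divide_right_mono)
      finally show ?thesis using True by (simp add: out)
    next
      case False
      then show ?thesis using \<open>0 < \<epsilon>\<close> by (auto simp: out)
    qed
    moreover have "heavy_hitters n \<epsilon> ?x \<subseteq> set out" if "\<exists>i<n. ?x i \<noteq> 0"
    proof
      fix i assume "i \<in> heavy_hitters n \<epsilon> ?x"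
      then have i: "i < n" "\<epsilon> * ?L \<le> ?x i"
        using x by (auto simp: heavy_hitters_def L)
      have "0 < ?L"
        using that x by (metis finite_lessThan lessThan_iff order_le_less sum_pos2)
      \<comment> \<open>No coordinate exceeds the norm, so the existence of a heavy hitter forces
        \<open>\<epsilon> \<le> 1\<close> and the guard of the query suppresses nothing.\<close>
      have "?x i \<le> ?L"
        using i x by (intro member_le_sum) auto
      with i have "\<epsilon> * ?L \<le> 1 * ?L" by linarith
      with \<open>0 < ?L\<close> have "\<epsilon> \<le> 1" by (simp only: mult_le_cancel_right_pos)
      moreover have "all_counters_ge ?x (\<epsilon> * ?L) i"
        using i counter_ge[of n ?x i _ D \<Gamma>] x by (force simp: all_counters_ge_def)
      ultimately show "i \<in> set out"
        using i \<open>0 < ?L\<close> by (simp add: out)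
    qed
    ultimately show ?thesis using run(1) by blast
  qed
  ultimately show "space \<sigma> \<le> m + s \<and>
      (\<forall>i \<Delta>. strict_turnstile n (us @ [(i, \<Delta>)]) \<longrightarrow>
        (\<exists>k out \<sigma>'. exec w (update_prog b P) (call i \<Delta> \<sigma>) k out \<sigma>' \<and> k \<le> C * t)) \<and>
      (\<exists>k out \<sigma>'. exec w (query_prog a b P) (call n \<epsilon> \<sigma>) k out \<sigma>' \<and> k \<le> C * (n * t) \<and>
        set out \<subseteq> {..<n} \<and> real (length out) \<le> C / \<epsilon> \<and>
        ((\<exists>i<n. ?x i \<noteq> 0) \<longrightarrow> heavy_hitters n \<epsilon> ?x \<subseteq> set out))"
    by blast
qed

end

theorem theorem21:
  fixes \<zeta> c :: real
  assumes "0 \<le> \<zeta>" and "\<zeta> < 1" and "2 / (1 - \<zeta>) < c"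
  shows "\<exists>C::nat. \<forall>P. \<exists>U Q.
    register_count {U, Q} \<le> register_count {P} + C \<and>
    (\<forall>w n m D s t (\<Gamma> :: nat \<Rightarrow> nat \<Rightarrow> nat) R (\<epsilon>::real).
       0 < \<epsilon> \<and> 0 < n \<and> n < 2 ^ w \<and> 0 < D \<and>
       bipartite_graph n D m \<Gamma> \<and> expanding n D \<Gamma> (c / \<epsilon>) \<zeta> \<and> stores_graph w P R n D \<Gamma> s t \<longrightarrow>
       (\<forall>M\<in>R. finds_heavy_hitters w U Q (init_state M m) n \<epsilon> (m + s) (C * t) (C * (n * t)) (C / \<epsilon>)))"
proof -
  \<comment> \<open>The rounded \<open>c\<close> serves the list length; 19 is the factor of the
    query time and also covers the 6 of the update and the 12 registers.\<close>
  define C where "C = nat \<lceil>c\<rceil> + 19"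
  have C: "19 \<le> C" "c \<le> real C" unfolding C_def by linarith+
  have bounded: "\<exists>k>0. A \<subseteq> {..<k}" if "finite A" for A :: "nat set"
    using that finite_nat_set_iff_bounded[of A] by (metis lessThan_iff less_SucI subsetI zero_less_Suc)
  show ?thesis
  proof (intro exI[of _ C] allI)
    fix P
    \<comment> \<open>Only the registers of \<open>P\<close> enter the choice of \<open>a\<close>
      and \<open>b\<close>, so the two programs do not depend on the graph, \<open>w\<close> or
      \<open>\<epsilon>\<close>.\<close>
    obtain a b where ab: "0 < a" "wregs P \<subseteq> {..<a}" "0 < b" "rregs P \<subseteq> {..<b}"
      using bounded finite_wregs finite_rregs by metis
    have "finds_heavy_hitters w (update_prog b P) (query_prog a b P) (init_state M m) n \<epsilon>
        (m + s) (C * t) (C * (n * t)) (C / \<epsilon>)"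
      if "0 < \<epsilon> \<and> 0 < n \<and> n < 2 ^ w \<and> 0 < D \<and> bipartite_graph n D m \<Gamma> \<and>
        expanding n D \<Gamma> (c / \<epsilon>) \<zeta> \<and> stores_graph w P R n D \<Gamma> s t" "M \<in> R"
      for w n m D s t \<Gamma> R \<epsilon> M
    proof -
      interpret stored_graph w n m D s t a b P R \<Gamma>
        using that ab by unfold_locales auto
      show ?thesis
        using that assms C by (intro finds_heavy_hitters_update_query[where \<zeta> = \<zeta> and c = c]) auto
    qed
    then show "\<exists>U Q. register_count {U, Q} \<le> register_count {P} + C \<and>
      (\<forall>w n m D s t (\<Gamma> :: nat \<Rightarrow> nat \<Rightarrow> nat) R (\<epsilon>::real).
         0 < \<epsilon> \<and> 0 < n \<and> n < 2 ^ w \<and> 0 < D \<and>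
         bipartite_graph n D m \<Gamma> \<and> expanding n D \<Gamma> (c / \<epsilon>) \<zeta> \<and> stores_graph w P R n D \<Gamma> s t \<longrightarrow>
         (\<forall>M\<in>R. finds_heavy_hitters w U Q (init_state M m) n \<epsilon> (m + s) (C * t) (C * (n * t)) (C / \<epsilon>)))"
      using register_count_update_query[of b P a] C
      by (intro exI[of _ "update_prog b P"] exI[of _ "query_prog a b P"]) auto
  qed
qed

end
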